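(* Let $n\ge 4$ and put $N=n$ if $n$ is even and $N=n-1$ if $n$ is odd. For even $T\ge 4$ and even $a$ with $2\le a\le T-2$ write $Q_T(a)=E_c(C_a^-)+E_c(C_{T-a}^+)$. For even $T$ with $6\le T\le N$ let $D(T)$ be the chain $Q_T(2)>Q_T(4)>\cdots>Q_T(T-4)$ (over consecutive even arguments). Then $$D(N)>D(N-2)>\cdots>D(6)>Q_4(2),$$ where each chain $D(T)$ is followed by $D(T-2)$ with its last element $Q_T(T-4)$ strictly greater than the first element $Q_{T-2}(2)$ of $D(T-2)$, and $Q_6(2)>Q_4(2)$ (if $N=4$ the chain consists of $Q_4(2)$ alone). Explicitly, for even $n$: $$E_c(C_2^-)+E_c(C_{n-2}^+)>E_c(C_4^-)+E_c(C_{n-4}^+)>\cdots>E_c(C_{n-4}^-)+E_c(C_4^+)>E_c(C_2^-)+E_c(C_{n-4}^+)>E_c(C_4^-)+E_c(C_{n-6}^+)>\cdots>E_c(C_{n-6}^-)+E_c(C_4^+)>E_c(C_2^-)+E_c(C_{n-6}^+)>\cdots>E_c(C_2^-)+E_c(C_2^+),$$ and for odd $n$ the same with $n$ replaced by $n-1$.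
   Context: For an integer $k\ge 2$, $C_k^+$ (resp. $C_k^-$) denotes a signed directed cycle on $k$ vertices $v_1,\dots,v_k$ with arcs $v_1v_2,\dots,v_{k-1}v_k,v_kv_1$, each arc carrying a sign $\pm1$, such that the product of the signs is $+1$ (resp. $-1$). Its adjacency matrix $A=(a_{ij})$ has $a_{ij}=\sigma(v_iv_j)$ if $v_iv_j$ is an arc and $0$ otherwise. The iota energy of a signed digraph with adjacency eigenvalues $z_1,\dots,z_k$ is $E_c=\sum_{j=1}^k|\mathrm{Im}(z_j)|$. Thus $E_c(C_k^+)=\sum_{j=0}^{k-1}|\sin\frac{2j\pi}{k}|$ and $E_c(C_k^-)=\sum_{j=0}^{k-1}|\sin\frac{(2j+1)\pi}{k}|$. The sums $E_c(C_a^-)+E_c(C_b^+)$ are the iota energies of bicyclic signed digraphs whose only directed cycles are a negative and a positive vertex-disjoint cycle of even lengths; the ordering above omits those whose positive cycle is $C_2^+$ (except the final term). *)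

theory Defs
  imports Complex_Main "Jordan_Normal_Form.Char_Poly"
begin

text \<open>A signed digraph on \<open>n\<close> vertices has vertex set \<open>{0..<n}\<close>; the vertex called
  \<open>v\<^sub>i\<close> in the usual notation is \<open>i - 1\<close> here.  The values of \<open>arc_sign\<close> outside
  \<open>arc_set\<close> are irrelevant.\<close>

record signed_digraph =
  nverts :: nat
  arc_set :: "(nat \<times> nat) set"
  arc_sign :: "nat \<times> nat \<Rightarrow> int"

definition wf_signed_digraph :: "signed_digraph \<Rightarrow> bool" where
  "wf_signed_digraph G \<longleftrightarrow>
     arc_set G \<subseteq> {0..<nverts G} \<times> {0..<nverts G} \<and>
     (\<forall>v. (v, v) \<notin> arc_set G) \<and>
     (\<forall>e\<in>arc_set G. arc_sign G e \<in> {1, -1})"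

definition adjacency_matrix :: "signed_digraph \<Rightarrow> complex mat" where
  "adjacency_matrix G = mat (nverts G) (nverts G)
     (\<lambda>(i, j). if (i, j) \<in> arc_set G then of_int (arc_sign G (i, j)) else 0)"

text \<open>The eigenvalues \<open>z\<^sub>1, \<dots>, z\<^sub>n\<close> are listed with algebraic multiplicity, that is, with
  their multiplicity as roots of the characteristic polynomial.\<close>

definition iota_energy :: "signed_digraph \<Rightarrow> real" where
  "iota_energy G =
     (\<Sum>z | eigenvalue (adjacency_matrix G) z.
        real (order z (char_poly (adjacency_matrix G))) * \<bar>Im z\<bar>)"

text \<open>For \<open>k = 2\<close> this is the digon with the two opposite arcs \<open>(0, 1)\<close> and \<open>(1, 0)\<close>.\<close>

definition signed_dicycle :: "nat \<Rightarrow> signed_digraph \<Rightarrow> bool" where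
  "signed_dicycle k G \<longleftrightarrow>
     k \<ge> 2 \<and> wf_signed_digraph G \<and> nverts G = k \<and>
     arc_set G = {(i, Suc i) | i. Suc i < k} \<union> {(k - 1, 0)}"

definition cycle_sign :: "signed_digraph \<Rightarrow> int" where
  "cycle_sign G = (\<Prod>e\<in>arc_set G. arc_sign G e)"

definition positive_dicycle :: "nat \<Rightarrow> signed_digraph \<Rightarrow> bool" where
  "positive_dicycle k G \<longleftrightarrow> signed_dicycle k G \<and> cycle_sign G = 1"

definition negative_dicycle :: "nat \<Rightarrow> signed_digraph \<Rightarrow> bool" where
  "negative_dicycle k G \<longleftrightarrow> signed_dicycle k G \<and> cycle_sign G = -1"

end

theory Submission
  imports Defs
begin

text \<open>A signed cycle of length \<open>k\<close> and sign \<open>s\<close> has as eigenvalues the \<open>k\<close>-th roots of \<open>s\<close>, and for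
  even \<open>k\<close> the sum of their absolute imaginary parts telescopes to \<open>2 cot (\<pi>/k)\<close> for \<open>s = 1\<close> and to
  \<open>2 / sin (\<pi>/k)\<close> for \<open>s = -1\<close>.  Within a chain the sum of the lengths is fixed, so the linear main
  terms \<open>k/\<pi>\<close> of both functions cancel; what remains is governed by \<open>1 / sin u - 1 / u\<close>, which
  increases with \<open>u\<close>, and \<open>cot u - 1 / u\<close>, which decreases.  Passing from one chain to the next only
  needs \<open>cot < 1 / sin\<close>.\<close>

section \<open>Multiplicities of polynomial roots\<close>

lemma sum_order_le_degree:
  fixes p :: "'a::idom poly"
  assumes "p \<noteq> 0"
  shows "(\<Sum>z | poly p z = 0. order z p) \<le> degree p"
proof -
  have "size (proots p) = (\<Sum>z | poly p z = 0. order z p)"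
    using assms by (simp add: size_multiset_overloaded_eq)
  then show ?thesis
    using size_proots_le[of p] by simp
qed

text \<open>Each root adds at least 1 to a sum of orders bounded by the degree. With as many
  distinct roots as the degree, no order can exceed 1.\<close>

lemma order_eq_1_if_card_roots_eq_degree:
  fixes p :: "'a::idom poly"
  assumes "p \<noteq> 0" "card {z. poly p z = 0} = degree p" "poly p w = 0"
  shows "order w p = 1"
proof -
  let ?R = "{z. poly p z = 0}"
  have fin: "finite ?R"
    using assms(1) by (rule poly_roots_finite)
  have pos: "order z p \<ge> 1" if "z \<in> ?R" for z
    using that assms(1) order_root[of p z] by (auto simp: Suc_le_eq)
  have "card ?R - 1 = (\<Sum>z\<in>?R - {w}. 1)"
    using assms(3) fin by (simp add: card_Diff_singleton)
  also have "\<dots> \<le> (\<Sum>z\<in>?R - {w}. order z p)"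
    using pos by (intro sum_mono) auto
  finally have "order w p + (card ?R - 1) \<le> (\<Sum>z\<in>?R. order z p)"
    using fin assms(3) by (subst sum.remove[of _ w]) auto
  moreover have "card ?R > 0"
    using fin assms(3) by (auto simp: card_gt_0_iff)
  ultimately have "order w p \<le> 1"
    using sum_order_le_degree[OF assms(1)] assms(2) by linarith
  then show ?thesis
    using pos[of w] assms(3) by simp
qed

section \<open>Spectrum of a signed cycle\<close>

lemma signed_dicycle_arc_set:
  assumes "signed_dicycle k G"
  shows "arc_set G = (\<lambda>i. (i, Suc i mod k)) ` {..<k}"
proof -
  have k: "k \<ge> 2" and arcs: "arc_set G = {(i, Suc i) | i. Suc i < k} \<union> {(k - 1, 0)}"
    using assms by (auto simp: signed_dicycle_def)
  have "{..<k} = insert (k - 1) {..<k - 1}"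
    using k by auto
  then have "(\<lambda>i. (i, Suc i mod k)) ` {..<k}
      = insert (k - 1, 0) ((\<lambda>i. (i, Suc i mod k)) ` {..<k - 1})"
    using k by auto
  also have "(\<lambda>i. (i, Suc i mod k)) ` {..<k - 1} = (\<lambda>i. (i, Suc i)) ` {..<k - 1}"
    by (intro image_cong) auto
  also have "\<dots> = {(i, Suc i) | i. Suc i < k}"
    by auto
  finally show ?thesis
    unfolding arcs by auto
qed

text \<open>An explicit eigenvector has as entry \<open>i\<close> the power \<open>z ^ i\<close>
  times the product of the first \<open>i\<close> signs. Row \<open>i\<close> of the matrix has one
  nonzero entry \<open>s i\<close>, and \<open>s i * s i = 1\<close> removes the extra sign.\<close>

lemma signed_dicycle_eigenvalue:
  assumes G: "signed_dicycle k G" and z: "z ^ k = of_int (cycle_sign G)"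
  shows "eigenvalue (adjacency_matrix G) z"
proof -
  define s :: "nat \<Rightarrow> complex" where "s i = of_int (arc_sign G (i, Suc i mod k))" for i
  define P where "P i = (\<Prod>j<i. s j)" for i
  define v where "v = vec k (\<lambda>i. z ^ i * P i)"
  let ?A = "adjacency_matrix G"
  have k: "k \<ge> 2" and nv: "nverts G = k" and wf: "wf_signed_digraph G"
    using G by (auto simp: signed_dicycle_def)
  note arcs = signed_dicycle_arc_set[OF G]
  have ss: "s i * s i = 1" if "i < k" for i
  proof -
    have "(i, Suc i mod k) \<in> arc_set G"
      using that unfolding arcs by auto
    then have "arc_sign G (i, Suc i mod k) \<in> {1, -1}"
      using wf unfolding wf_signed_digraph_def by blast
    then show ?thesis
      by (auto simp: s_def)
  qed
  have PP: "P i * P i = 1" if "i \<le> k" for i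
    using that ss by (simp add: P_def flip: prod.distrib)
  have "cycle_sign G = (\<Prod>i<k. arc_sign G (i, Suc i mod k))"
    unfolding cycle_sign_def arcs by (subst prod.reindex) (auto simp: inj_on_def)
  then have zk: "z ^ k = P k"
    using z by (simp add: P_def s_def)
  have entry: "?A $$ (i, j) = (if j = Suc i mod k then s i else 0)" if "i < k" "j < k" for i j
    using that by (auto simp: adjacency_matrix_def nv arcs s_def)
  have mult: "(?A *\<^sub>v v) $ i = s i * v $ (Suc i mod k)" if i: "i < k" for i
  proof -
    have "(?A *\<^sub>v v) $ i = (\<Sum>j<k. ?A $$ (i, j) * v $ j)"
      using i by (simp add: adjacency_matrix_def nv v_def scalar_prod_def atLeast0LessThan)
    also have "\<dots> = (\<Sum>j<k. if j = Suc i mod k then s i * v $ j else 0)"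
      using i entry by (intro sum.cong) auto
    also have "\<dots> = s i * v $ (Suc i mod k)"
      using i by simp
    finally show ?thesis .
  qed
  have step: "s i * v $ (Suc i mod k) = z * v $ i" if i: "i < k" for i
  proof (cases "Suc i < k")
    case True
    then show ?thesis
      using ss[OF i] by (simp add: v_def P_def)
  next
    \<comment> \<open>The closing row leads back to \<open>v $ 0 = 1\<close>, so
      \<open>z ^ k = P k\<close> enters here. Multiplying by \<open>P i\<close>, which is its own
      inverse, isolates \<open>s i\<close>.\<close>
    case False
    then have "k = Suc i"
      using i by simp
    then have "z * z ^ i = P i * s i"
      using zk by (simp add: P_def)
    then have "z * (z ^ i * P i) = (P i * P i) * s i"
      by (metis mult.assoc mult.commute)
    then show ?thesis
      using \<open>k = Suc i\<close> PP[of i] by (simp add: v_def, simp add: P_def)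
  qed
  have "v $ 0 \<noteq> 0"
    using k by (simp add: v_def P_def)
  then have "v \<noteq> 0\<^sub>v k"
    using k by auto
  moreover have "?A *\<^sub>v v = z \<cdot>\<^sub>v v"
  proof (rule eq_vecI)
    fix i assume "i < dim_vec (z \<cdot>\<^sub>v v)"
    then have i: "i < k"
      by (simp add: v_def)
    then have "(z \<cdot>\<^sub>v v) $ i = z * v $ i"
      by (simp add: v_def)
    then show "(?A *\<^sub>v v) $ i = (z \<cdot>\<^sub>v v) $ i"
      using mult[OF i] step[OF i] by simp
  qed (simp add: adjacency_matrix_def nv v_def)
  ultimately have "eigenvector ?A v z"
    by (simp add: eigenvector_def adjacency_matrix_def nv v_def)
  then show ?thesis
    by (auto simp: eigenvalue_def)
qed

text \<open>There are \<open>k\<close> distinct roots of \<open>z\<^sup>k = \<plusminus>1\<close> and the characteristic polynomial has degree \<open>k\<close>,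
  so these are all the eigenvalues and they are simple; no determinant has to be expanded.\<close>

lemma iota_energy_signed_dicycle:
  assumes G: "signed_dicycle k G" and s: "cycle_sign G \<noteq> 0"
  shows "iota_energy G = (\<Sum>z | z ^ k = of_int (cycle_sign G). \<bar>Im z\<bar>)"
proof -
  let ?A = "adjacency_matrix G" and ?S = "{z::complex. z ^ k = of_int (cycle_sign G)}"
  let ?R = "{z. poly (char_poly ?A) z = 0}"
  have k: "k \<ge> 2" and A: "?A \<in> carrier_mat k k"
    using G by (auto simp: signed_dicycle_def adjacency_matrix_def)
  have deg: "degree (char_poly ?A) = k" and nz: "char_poly ?A \<noteq> 0"
    using degree_monic_char_poly[OF A] by auto
  note ev = eigenvalue_root_char_poly[OF A]
  have fin: "finite ?R"
    using nz by (rule poly_roots_finite)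
  have sub: "?S \<subseteq> ?R"
    using signed_dicycle_eigenvalue[OF G] ev by auto
  have card: "card ?S = k"
    using k s by (intro card_nth_roots) auto
  have "card ?R \<le> k"
    using poly_roots_degree[OF nz] deg by simp
  then have eq: "?S = ?R"
    using card_seteq[OF fin sub] card by simp
  then have "order z (char_poly ?A) = 1" if "z \<in> ?S" for z
    using order_eq_1_if_card_roots_eq_degree[OF nz, of z] that card deg by auto
  then show ?thesis
    unfolding iota_energy_def ev eq[symmetric] by (intro sum.cong) auto
qed

section \<open>Closed forms of the energies\<close>

text \<open>The listed roots are the \<open>k\<close>-th roots of unity turned by
  \<open>cis (t / real k)\<close>, hence distinct; as there are \<open>k\<close> of them, none is
  missing.\<close>

lemma sum_abs_Im_roots_cis:
  assumes "k > 0"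
  shows "(\<Sum>z | z ^ k = cis t. \<bar>Im z\<bar>) = (\<Sum>j<k. \<bar>sin ((t + 2 * pi * real j) / real k)\<bar>)"
proof -
  let ?f = "\<lambda>j. cis ((t + 2 * pi * real j) / real k)"
  have split: "?f j = cis (t / real k) * cis (2 * pi * real j / real k)" for j
    by (simp add: cis_mult add_divide_distrib)
  have "inj_on ?f {..<k}"
    using bij_betw_imp_inj_on[OF bij_betw_roots_unity[OF assms]]
    unfolding split by (auto simp: inj_on_def)
  moreover have "?f ` {..<k} = {z. z ^ k = cis t}"
  proof (rule card_seteq)
    show "finite {z. z ^ k = cis t}"
      using assms by (intro finite_nth_roots) auto
    show "?f ` {..<k} \<subseteq> {z. z ^ k = cis t}"
      using assms by (auto simp: DeMoivre cis_mult[symmetric])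
    show "card {z. z ^ k = cis t} \<le> card (?f ` {..<k})"
      using assms by (simp add: card_nth_roots card_image[OF \<open>inj_on ?f {..<k}\<close>])
  qed
  ultimately have "bij_betw ?f {..<k} {z. z ^ k = cis t}"
    by (simp add: bij_betw_def)
  from sum.reindex_bij_betw[OF this, of "\<lambda>z. \<bar>Im z\<bar>"] show ?thesis
    by simp
qed

text \<open>Shifting \<open>j\<close> by half of \<open>k\<close> adds \<open>pi\<close> to the
  angle, so the sum is twice its first half, where no sine is negative. Multiplied by
  \<open>2 * sin (pi / real k)\<close>, that half telescopes. The cases \<open>t = 0\<close> and
  \<open>t = pi\<close> serve the positive and the negative cycle.\<close>

lemma sum_abs_sin_even:
  assumes k: "even k" "k > 0" and t: "0 \<le> t" "t \<le> pi"
  shows "(\<Sum>j<k. \<bar>sin ((t + 2 * pi * real j) / real k)\<bar>) = 2 * cos ((pi - t) / real k) / sin (pi / real k)"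
proof -
  obtain m where m: "k = 2 * m" "m > 0"
    using k by auto
  define x where "x j = (t + 2 * pi * real j) / real k" for j :: nat
  let ?h = "pi / real k"
  have shift: "x (m + j) = x j + pi" for j
    using m by (simp add: x_def field_simps)
  have nonneg: "sin (x j) \<ge> 0" if "j < m" for j
  proof (rule sin_ge_zero)
    show "0 \<le> x j"
      using t by (simp add: x_def)
    have "t + 2 * pi * real j \<le> pi * (2 * real j + 1)"
      using t by (simp add: algebra_simps)
    also have "\<dots> \<le> pi * real k"
      using that m by (intro mult_left_mono) auto
    finally show "x j \<le> pi"
      using k by (simp add: x_def field_simps)
  qed
  have "(\<Sum>j<k. \<bar>sin (x j)\<bar>) = (\<Sum>j<m. \<bar>sin (x j)\<bar>) + (\<Sum>j=m..<m + m. \<bar>sin (x j)\<bar>)"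
    using sum.atLeastLessThan_concat[of 0 m "m + m" "\<lambda>j. \<bar>sin (x j)\<bar>"] m
    by (simp add: atLeast0LessThan mult_2)
  also have "(\<Sum>j=m..<m + m. \<bar>sin (x j)\<bar>) = (\<Sum>j<m. \<bar>sin (x (m + j))\<bar>)"
    using sum.shift_bounds_nat_ivl[of "\<lambda>j. \<bar>sin (x j)\<bar>" 0 m m]
    by (simp add: atLeast0LessThan add.commute)
  also have "\<dots> = (\<Sum>j<m. \<bar>sin (x j)\<bar>)"
    by (simp add: shift)
  also have "(\<Sum>j<m. \<bar>sin (x j)\<bar>) = (\<Sum>j<m. sin (x j))"
    using nonneg by (intro sum.cong) auto
  finally have twice: "(\<Sum>j<k. \<bar>sin (x j)\<bar>) = 2 * (\<Sum>j<m. sin (x j))"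
    by simp
  \<comment> \<open>Neighbouring angles differ by \<open>2 * ?h\<close>, so the upper end
    \<open>x j + ?h\<close> of one difference is the lower end of the next.\<close>
  have "2 * sin ?h * sin (x j) = cos (x j - ?h) - cos (x (Suc j) - ?h)" for j
  proof -
    have "x (Suc j) - ?h = x j + ?h"
      by (simp add: x_def add_divide_distrib algebra_simps)
    then show ?thesis
      by (simp add: cos_add cos_diff)
  qed
  then have "2 * sin ?h * (\<Sum>j<m. sin (x j)) = cos (x 0 - ?h) - cos (x m - ?h)"
    by (simp only: sum_distrib_left sum_lessThan_telescope'[of "\<lambda>j. cos (x j - ?h)"])
  also have "x m - ?h = (x 0 - ?h) + pi"
    using shift[of 0] by simp
  also have "cos (x 0 - ?h) = cos ((pi - t) / real k)"
    using cos_minus[of "x 0 - ?h"] by (simp add: x_def diff_divide_distrib)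
  then have "cos (x 0 - ?h) - cos ((x 0 - ?h) + pi) = 2 * cos ((pi - t) / real k)"
    by simp
  finally have "2 * sin ?h * (\<Sum>j<m. sin (x j)) = 2 * cos ((pi - t) / real k)" .
  moreover have "sin ?h > 0"
    using m by (intro sin_gt_zero) (auto simp: field_simps)
  ultimately show ?thesis
    using twice by (simp add: x_def field_simps)
qed

lemma iota_energy_positive_dicycle:
  assumes "positive_dicycle k G" "even k"
  shows "iota_energy G = 2 * cot (pi / real k)"
proof -
  have G: "signed_dicycle k G" and s: "cycle_sign G = 1" and k: "k > 0"
    using assms by (auto simp: positive_dicycle_def signed_dicycle_def)
  have "iota_energy G = (\<Sum>z | z ^ k = cis 0. \<bar>Im z\<bar>)"
    using iota_energy_signed_dicycle[OF G] s by simp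
  also have "\<dots> = 2 * cos ((pi - 0) / real k) / sin (pi / real k)"
    unfolding sum_abs_Im_roots_cis[OF k] using assms k by (intro sum_abs_sin_even) auto
  finally show ?thesis
    by (simp add: cot_def)
qed

lemma iota_energy_negative_dicycle:
  assumes "negative_dicycle k G" "even k"
  shows "iota_energy G = 2 / sin (pi / real k)"
proof -
  have G: "signed_dicycle k G" and s: "cycle_sign G = -1" and k: "k > 0"
    using assms by (auto simp: negative_dicycle_def signed_dicycle_def)
  have "iota_energy G = (\<Sum>z | z ^ k = cis pi. \<bar>Im z\<bar>)"
    using iota_energy_signed_dicycle[OF G] s by simp
  also have "\<dots> = 2 * cos ((pi - pi) / real k) / sin (pi / real k)"
    unfolding sum_abs_Im_roots_cis[OF k] using assms k by (intro sum_abs_sin_even) auto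
  finally show ?thesis
    by simp
qed

section \<open>Trigonometric inequalities and monotonicity\<close>

lemma sin_less_self:
  fixes x :: real
  assumes "0 < x" "x < pi"
  shows "sin x < x"
proof -
  have "\<exists>y>0. y < x \<and> sin x - sin 0 = (x - 0) * cos y"
    using assms by (intro MVT2) (auto intro!: derivative_eq_intros)
  then obtain y where y: "0 < y" "y < x" "sin x = x * cos y"
    by auto
  have "cos y < cos 0"
    using y assms by (intro cos_monotone_0_pi) auto
  then show ?thesis
    using y assms by simp
qed

text \<open>The difference \<open>sin x - x * cos x\<close> vanishes at 0 and has derivative
  \<open>x * sin x\<close>, which is positive on the interval.\<close>

lemma mult_cos_less_sin:
  fixes x :: real
  assumes "0 < x" "x < pi"
  shows "x * cos x < sin x"
proof -
  have "\<exists>y>0. y < x \<and> (sin x - x * cos x) - (sin 0 - 0 * cos 0) = (x - 0) * (y * sin y)"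
    using assms(1) by (intro MVT2) (auto intro!: derivative_eq_intros)
  then obtain y where "0 < y" "y < x" "sin x - x * cos x = x * (y * sin y)"
    by auto
  then show ?thesis
    using assms sin_gt_zero[of y] by (smt (verit) mult_pos_pos)
qed

text \<open>Squaring \<open>x * cos x < sin x\<close> directly would bound only the square of
  \<open>cos x\<close>. Applied to \<open>v = x / 2\<close> the inequality suffices, because
  \<open>cos x\<close> is at most the fourth power of \<open>cos v\<close>.\<close>

lemma sq_mult_cos_less_sin_sq:
  fixes x :: real
  assumes "0 < x" "x < pi"
  shows "x\<^sup>2 * cos x < (sin x)\<^sup>2"
proof -
  define v where "v = x / 2"
  have v: "0 < v" "v < pi / 2" and x: "x = 2 * v"
    using assms by (auto simp: v_def)
  have c: "cos v > 0"
    using v by (intro cos_gt_zero) auto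
  have "cos x \<le> (cos v)\<^sup>2 * (cos v)\<^sup>2"
  proof -
    have "(cos v)\<^sup>2 * (cos v)\<^sup>2 - cos x = ((cos v)\<^sup>2 - 1)\<^sup>2"
      unfolding x cos_double_cos by (simp add: power2_eq_square algebra_simps)
    then show ?thesis
      by (smt (verit) zero_le_power2)
  qed
  then have "x\<^sup>2 * cos x \<le> x\<^sup>2 * ((cos v)\<^sup>2 * (cos v)\<^sup>2)"
    by (intro mult_left_mono) auto
  also have "\<dots> = (2 * (v * cos v) * cos v)\<^sup>2"
    by (simp add: x power_mult_distrib)
  also have "\<dots> < (2 * sin v * cos v)\<^sup>2"
    using mult_cos_less_sin[of v] v c
    by (intro power_strict_mono) auto
  also have "\<dots> = (sin x)\<^sup>2"
    by (simp add: x sin_double)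
  finally show ?thesis .
qed

text \<open>After clearing denominators, positivity of the derivative is
  \<open>u\<^sup>2 * cos u < (sin u)\<^sup>2\<close>.\<close>

lemma inverse_sin_minus_inverse_strict_mono:
  fixes x y :: real
  assumes "0 < x" "x < y" "y < pi"
  shows "1 / sin x - 1 / x < 1 / sin y - 1 / y"
proof (rule DERIV_pos_imp_increasing[OF assms(2)], intro exI conjI)
  fix u assume "x \<le> u" "u \<le> y"
  then have u: "0 < u" "u < pi"
    using assms by auto
  then have s: "sin u > 0"
    by (rule sin_gt_zero)
  show "((\<lambda>u. 1 / sin u - 1 / u) has_real_derivative 1 / u\<^sup>2 - cos u / (sin u)\<^sup>2) (at u)"
    using u s by (auto intro!: derivative_eq_intros simp: power2_eq_square)
  show "0 < 1 / u\<^sup>2 - cos u / (sin u)\<^sup>2"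
    using sq_mult_cos_less_sin_sq[OF u] u s by (simp add: field_simps)
qed

lemma cot_minus_inverse_strict_antimono:
  fixes x y :: real
  assumes "0 < x" "x < y" "y < pi"
  shows "cot y - 1 / y < cot x - 1 / x"
proof (rule DERIV_neg_imp_decreasing[OF assms(2)], intro exI conjI)
  fix u assume "x \<le> u" "u \<le> y"
  then have u: "0 < u" "u < pi"
    using assms by auto
  then have s: "sin u > 0"
    by (rule sin_gt_zero)
  show "((\<lambda>u. cot u - 1 / u) has_real_derivative 1 / u\<^sup>2 - inverse ((sin u)\<^sup>2)) (at u)"
    using u s by (auto intro!: derivative_eq_intros DERIV_cot simp: power2_eq_square simp del: inverse_mult_distrib)
  have "(sin u)\<^sup>2 < u\<^sup>2"
    using sin_less_self[OF u] s by (intro power_strict_mono) auto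
  then show "1 / u\<^sup>2 - inverse ((sin u)\<^sup>2) < 0"
    using u s by (simp add: field_simps)
qed

text \<open>As \<open>a\<close> grows, \<open>pi / a\<close> falls and \<open>pi / (T - a)\<close>
  rises, so both remainders decrease; the subtracted terms add up to \<open>T / pi\<close> on either
  side. The bounds \<open>1 < a\<close> and \<open>a' < T - 1\<close> keep all angles below
  \<open>pi\<close>.\<close>

lemma inverse_sin_plus_cot_strict_antimono:
  fixes a a' T :: real
  assumes "1 < a" "a < a'" "a' < T - 1"
  shows "1 / sin (pi / a') + cot (pi / (T - a')) < 1 / sin (pi / a) + cot (pi / (T - a))"
proof -
  have "pi / (T - a) < pi / (T - a')"
    using assms by (intro divide_strict_left_mono) auto
  moreover have "pi / (T - a') < pi"
    using assms by (simp add: divide_less_eq)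
  ultimately have "cot (pi / (T - a')) - 1 / (pi / (T - a')) < cot (pi / (T - a)) - 1 / (pi / (T - a))"
    using assms by (intro cot_minus_inverse_strict_antimono) auto
  moreover have "1 / sin (pi / a') - 1 / (pi / a') < 1 / sin (pi / a) - 1 / (pi / a)"
    using assms by (intro inverse_sin_minus_inverse_strict_mono) (auto simp: field_simps)
  ultimately show ?thesis
    by (simp add: diff_divide_distrib)
qed

lemma cot_less_inverse_sin:
  fixes x :: real
  assumes "0 < x" "x < pi"
  shows "cot x < 1 / sin x"
proof -
  have "cos x < cos 0"
    using assms by (intro cos_monotone_0_pi) auto
  then show ?thesis
    using sin_gt_zero[OF assms] by (simp add: cot_def divide_strict_right_mono)
qed

theorem theorem3p6:
  fixes n N :: nat
    and Cpos Cneg :: "nat \<Rightarrow> signed_digraph"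
    and Q :: "nat \<Rightarrow> nat \<Rightarrow> real"
  assumes n: "n \<ge> 4"
    and N: "N = (if even n then n else n - 1)"
    and Cpos: "\<And>k. k \<ge> 2 \<Longrightarrow> positive_dicycle k (Cpos k)"
    and Cneg: "\<And>k. k \<ge> 2 \<Longrightarrow> negative_dicycle k (Cneg k)"
    and Q: "\<And>T a. even T \<Longrightarrow> T \<ge> 4 \<Longrightarrow> even a \<Longrightarrow> 2 \<le> a \<Longrightarrow> a \<le> T - 2 \<Longrightarrow>
              Q T a = iota_energy (Cneg a) + iota_energy (Cpos (T - a))"
  shows "(\<forall>T a. even T \<and> 6 \<le> T \<and> T \<le> N \<and> even a \<and> 2 \<le> a \<and> a + 2 \<le> T - 4
             \<longrightarrow> Q T a > Q T (a + 2))
       \<and> (\<forall>T. even T \<and> 8 \<le> T \<and> T \<le> N \<longrightarrow> Q T (T - 4) > Q (T - 2) 2)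
       \<and> (6 \<le> N \<longrightarrow> Q 6 2 > Q 4 2)"
proof -
  have Q': "Q T a = 2 * (1 / sin (pi / real a) + cot (pi / (real T - real a)))"
    if "even T" "4 \<le> T" "even a" "2 \<le> a" "a \<le> T - 2" for T a
  proof -
    have "positive_dicycle (T - a) (Cpos (T - a))" "negative_dicycle a (Cneg a)"
      using that by (auto intro!: Cpos Cneg)
    then show ?thesis
      using Q[OF that] that
      by (simp add: iota_energy_positive_dicycle iota_energy_negative_dicycle)
  qed
  have cot_quarter: "cot (pi / 4) = (1::real)"
    by (simp add: cot_def sin_45 cos_45)
  have cot_half: "cot (pi / 2) = (0::real)"
    by (simp add: cot_def)
  have chain: "Q T (a + 2) < Q T a"
    if "even T" "6 \<le> T" "even a" "2 \<le> a" "a + 2 \<le> T - 4" for T a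
  proof -
    have "real (a + 2) + 4 \<le> real T"
      using that by linarith
    then show ?thesis
      using that inverse_sin_plus_cot_strict_antimono[of "real a" "real (a + 2)" "real T"]
      by (simp add: Q')
  qed
  have link: "Q (T - 2) 2 < Q T (T - 4)" if "even T" "8 \<le> T" for T
  proof -
    \<comment> \<open>Both energies contain a cycle of length \<open>T - 4\<close>, positive in
      \<open>Q (T - 2) 2\<close> and negative in \<open>Q T (T - 4)\<close>. The other cycle
      contributes 2 each time, since \<open>sin (pi / 2) = 1\<close> and
      \<open>cot (pi / 4) = 1\<close>.\<close>
    let ?x = "pi / (real T - 4)"
    have "Q (T - 2) 2 = 2 * (1 + cot ?x)"
      using that by (simp add: Q')
    moreover have "Q T (T - 4) = 2 * (1 / sin ?x + 1)"
      using that by (simp add: Q' cot_quarter)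
    moreover have "cot ?x < 1 / sin ?x"
      using that by (intro cot_less_inverse_sin) (auto simp: field_simps)
    ultimately show ?thesis
      by simp
  qed
  \<comment> \<open>The two values are 2 and 4.\<close>
  have "Q 4 2 < Q 6 2"
    by (simp add: Q' cot_quarter cot_half)
  with chain link show ?thesis
    by blast
qed

end
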